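(* Let $\mathcal{X}\subset\mathbb{R}^n$ be either an open subset or a smooth submanifold of $\mathbb{R}^n$, let $f$ be a locally Lipschitz vector field on $\mathcal{X}$, and consider the dynamical system $\Sigma:\ \dot x=f(x)$, $x\in\mathcal{X}$, with solutions $\phi(t,x_0)$. Let $\Gamma\subset\mathcal{O}\subset\mathcal{X}$ be two closed sets which are positively invariant for $\Sigma$. Suppose that: (i) $\Gamma$ is asymptotically stable relative to $\mathcal{O}$; (ii) $\mathcal{O}$ is locally stable near $\Gamma$; (iv) if $\Gamma$ is unbounded, then $\Sigma$ is locally uniformly bounded near $\Gamma$. Then $\Gamma$ is stable for $\Sigma$.
   Context: Notation: $\mathbb{R}^+=[0,+\infty)$; $\phi(t,x_0)$ is the unique solution of $\dot x=f(x)$ with $\phi(0,x_0)=x_0$; for $I\subset\mathbb{R}$ and $S\subset\mathcal{X}$, $\phi(I,S)=\{\phi(t,x_0):t\in I,x_0\in S\}$. For a nonempty closed set $S$, $\|x\|_S=\inf\{\|x-y\|:y\in S\}$; $B_\alpha(x)=\{y\in\mathcal{X}:\|y-x\|<\alpha\}$ and $B_\alpha(S)=\{y\in\mathcal{X}:\|y\|_S<\alpha\}$. $\mathcal{N}(S)$ denotes an open subset of $\mathcal{X}$ containing $S$ (a neighbourhood of $S$). Statements involving $t\to\infty$ or $\phi(\mathbb{R}^+,\cdot)$ presuppose that the solutions concerned are defined for all $t\ge0$. A set $S$ is positively invariant if $\phi(t,x_0)\in S$ for all $x_0\in S$ and all $t\ge0$. Let $\Gamma\subset\mathcal{X}$ be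 closed and positively invariant. $\Gamma$ is stable if for all $\varepsilon>0$ there is a neighbourhood $\mathcal{N}(\Gamma)$ with $\phi(\mathbb{R}^+,\mathcal{N}(\Gamma))\subset B_\varepsilon(\Gamma)$. For $\mathcal{O}\subset\mathcal{X}$ with $\mathcal{O}\cap\Gamma\ne\emptyset$: $\Gamma$ is stable relative to $\mathcal{O}$ if for every $\varepsilon>0$ there is $\mathcal{N}(\Gamma)$ with $\phi(\mathbb{R}^+,\mathcal{N}(\Gamma)\cap\mathcal{O})\subset B_\varepsilon(\Gamma)$; $\Gamma$ is attractive relative to $\mathcal{O}$ if there is $\mathcal{N}(\Gamma)$ such that $\lim_{t\to\infty}\|\phi(t,x_0)\|_\Gamma=0$ for all $x_0\in\mathcal{N}(\Gamma)\cap\mathcal{O}$; $\Gamma$ is asymptotically stable relative to $\mathcal{O}$ if it is both stable and attractive relative to $\mathcal{O}$. For positively invariant sets $\Gamma\subset\mathcal{O}\subset\mathcal{X}$, $\mathcal{O}$ is locally stable near $\Gamma$ if for all $x\in\Gamma$, all $c>0$ and all $\varepsilon>0$ there exists $\delta>0$ such that for all $x_0\in B_\delta(\Gamma)$ and all $t>0$, whenever $\phi([0,t],x_0)\subset B_c(x)$ one has $\phi([0,t],x_0)\subset B_\varepsilon(\mathcal{O})$. $\Sigma$ is locally uniformly bounded near $\Gamma$ if for each $x\in\Gamma$ there exist positive scalars $\lambda$ and $m$ such that $\phi(\mathbb{R}^+,B_\lambda(x))\subset B_m(x)$. *)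

theory Defs
  imports "HOL-Analysis.Analysis"
begin

section \<open>Smooth maps, embedded submanifolds, tangent vectors\<close>

text \<open>Class \<open>C^k\<close> on an open set, by iterated directional derivatives.\<close>

primrec C_k_on ::
  "nat \<Rightarrow> 'a::real_normed_vector set \<Rightarrow> ('a \<Rightarrow> 'b::real_normed_vector) \<Rightarrow> bool" where
  "C_k_on 0 S f \<longleftrightarrow> continuous_on S f"
| "C_k_on (Suc k) S f \<longleftrightarrow> (\<forall>x\<in>S. f differentiable (at x)) \<and>
     (\<forall>v. C_k_on k S (\<lambda>x. frechet_derivative f (at x) v))"

definition smooth_on ::
  "'a::real_normed_vector set \<Rightarrow> ('a \<Rightarrow> 'b::real_normed_vector) \<Rightarrow> bool" where
  "smooth_on S f \<longleftrightarrow> (\<forall>k. C_k_on k S f)"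

text \<open>Embedded submanifolds without boundary, by local straightening diffeomorphisms of the
  ambient space.\<close>

definition smooth_submanifold :: "nat \<Rightarrow> (real ^ 'n) set \<Rightarrow> bool" where
  "smooth_submanifold k X \<longleftrightarrow>
     (\<forall>p\<in>X. \<exists>U V \<psi> \<psi>' L.
        open U \<and> p \<in> U \<and> open (V :: (real ^ 'n) set) \<and>
        homeomorphism U V \<psi> \<psi>' \<and> smooth_on U \<psi> \<and> smooth_on V \<psi>' \<and>
        subspace L \<and> dim L = k \<and> \<psi> ` (X \<inter> U) = V \<inter> L)"

text \<open>Velocities at \<open>x\<close> of smooth curves in \<open>X\<close>. If \<open>X\<close> is open, this is the whole space.\<close>

definition tangent_space :: "(real ^ 'n) set \<Rightarrow> real ^ 'n \<Rightarrow> (real ^ 'n) set" where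
  "tangent_space X x =
     {v. \<exists>\<gamma>. \<exists>e>0. smooth_on {-e<..<e} \<gamma> \<and> \<gamma> ` {-e<..<e} \<subseteq> X \<and>
            \<gamma> (0::real) = x \<and> (\<gamma> has_vector_derivative v) (at 0)}"

definition locally_lipschitz_vector_field ::
  "(real ^ 'n) set \<Rightarrow> (real ^ 'n \<Rightarrow> real ^ 'n) \<Rightarrow> bool" where
  "locally_lipschitz_vector_field X f \<longleftrightarrow>
     (\<forall>x\<in>X. f x \<in> tangent_space X x) \<and> local_lipschitz (UNIV :: real set) X (\<lambda>_. f)"

section \<open>The flow\<close>

definition ode_solution ::
  "(real ^ 'n) set \<Rightarrow> (real ^ 'n \<Rightarrow> real ^ 'n) \<Rightarrow> real set \<Rightarrow> real ^ 'n \<Rightarrow> (real \<Rightarrow> real ^ 'n) \<Rightarrow> bool"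
  where
  "ode_solution X f I x0 u \<longleftrightarrow>
     is_interval I \<and> 0 \<in> I \<and> u 0 = x0 \<and>
     (\<forall>t\<in>I. u t \<in> X \<and> (u has_vector_derivative f (u t)) (at t within I))"

text \<open>The maximal interval of existence of the solution through \<open>x0\<close>.\<close>

definition existence_interval ::
  "(real ^ 'n) set \<Rightarrow> (real ^ 'n \<Rightarrow> real ^ 'n) \<Rightarrow> real ^ 'n \<Rightarrow> real set" where
  "existence_interval X f x0 = {t. \<exists>I u. t \<in> I \<and> ode_solution X f I x0 u}"

text \<open>The value is only meaningful for \<open>t \<in> existence_interval X f x0\<close>; every use of
  \<open>flow\<close> below is accompanied by this condition.\<close>

definition flow ::
  "(real ^ 'n) set \<Rightarrow> (real ^ 'n \<Rightarrow> real ^ 'n) \<Rightarrow> real \<Rightarrow> real ^ 'n \<Rightarrow> real ^ 'n" where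
  "flow X f t x0 = (THE y. \<exists>I u. t \<in> I \<and> ode_solution X f I x0 u \<and> u t = y)"

text \<open>\<open>\<phi>(I, S) \<subseteq> B\<close>, including that the solutions from \<open>S\<close> are defined on all of \<open>I\<close>.\<close>

definition flow_into ::
  "(real ^ 'n) set \<Rightarrow> (real ^ 'n \<Rightarrow> real ^ 'n) \<Rightarrow> real set \<Rightarrow> (real ^ 'n) set \<Rightarrow> (real ^ 'n) set \<Rightarrow> bool"
  where
  "flow_into X f I S B \<longleftrightarrow>
     (\<forall>x0\<in>S. \<forall>t\<in>I. t \<in> existence_interval X f x0 \<and> flow X f t x0 \<in> B)"

section \<open>Stability of sets\<close>

text \<open>For nonempty \<open>S\<close>, the distance \<open>\<parallel>x\<parallel>\<^sub>S\<close> is \<^term>\<open>infdist x S\<close>; the ball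
  \<open>B\<^sub>\<alpha>(x)\<close> in \<open>X\<close> is \<^term>\<open>ball x \<alpha> \<inter> X\<close>.\<close>

definition set_ball :: "(real ^ 'n) set \<Rightarrow> real \<Rightarrow> (real ^ 'n) set \<Rightarrow> (real ^ 'n) set" where
  "set_ball X \<alpha> S = {y \<in> X. infdist y S < \<alpha>}"

definition nbhd_of :: "(real ^ 'n) set \<Rightarrow> (real ^ 'n) set \<Rightarrow> (real ^ 'n) set \<Rightarrow> bool" where
  "nbhd_of X S N \<longleftrightarrow> openin (top_of_set X) N \<and> S \<subseteq> N"

definition positively_invariant ::
  "(real ^ 'n) set \<Rightarrow> (real ^ 'n \<Rightarrow> real ^ 'n) \<Rightarrow> (real ^ 'n) set \<Rightarrow> bool" where
  "positively_invariant X f S \<longleftrightarrow> flow_into X f {0..} S S"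

definition stable_set ::
  "(real ^ 'n) set \<Rightarrow> (real ^ 'n \<Rightarrow> real ^ 'n) \<Rightarrow> (real ^ 'n) set \<Rightarrow> bool" where
  "stable_set X f \<Gamma> \<longleftrightarrow>
     (\<forall>\<epsilon>>0. \<exists>N. nbhd_of X \<Gamma> N \<and> flow_into X f {0..} N (set_ball X \<epsilon> \<Gamma>))"

definition stable_relative ::
  "(real ^ 'n) set \<Rightarrow> (real ^ 'n \<Rightarrow> real ^ 'n) \<Rightarrow> (real ^ 'n) set \<Rightarrow> (real ^ 'n) set \<Rightarrow> bool" where
  "stable_relative X f \<Gamma> \<O> \<longleftrightarrow>
     (\<forall>\<epsilon>>0. \<exists>N. nbhd_of X \<Gamma> N \<and> flow_into X f {0..} (N \<inter> \<O>) (set_ball X \<epsilon> \<Gamma>))"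

definition attractive_relative ::
  "(real ^ 'n) set \<Rightarrow> (real ^ 'n \<Rightarrow> real ^ 'n) \<Rightarrow> (real ^ 'n) set \<Rightarrow> (real ^ 'n) set \<Rightarrow> bool" where
  "attractive_relative X f \<Gamma> \<O> \<longleftrightarrow>
     (\<exists>N. nbhd_of X \<Gamma> N \<and>
        (\<forall>x0 \<in> N \<inter> \<O>. {0..} \<subseteq> existence_interval X f x0 \<and>
           ((\<lambda>t. infdist (flow X f t x0) \<Gamma>) \<longlongrightarrow> 0) at_top))"

definition asymptotically_stable_relative ::
  "(real ^ 'n) set \<Rightarrow> (real ^ 'n \<Rightarrow> real ^ 'n) \<Rightarrow> (real ^ 'n) set \<Rightarrow> (real ^ 'n) set \<Rightarrow> bool" where
  "asymptotically_stable_relative X f \<Gamma> \<O> \<longleftrightarrow>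
     stable_relative X f \<Gamma> \<O> \<and> attractive_relative X f \<Gamma> \<O>"

text \<open>Solutions starting off \<open>\<O>\<close> need not exist for all \<open>t \<ge> 0\<close> here; the premise on
  \<open>[0, t]\<close> contains existence up to time \<open>t\<close>.\<close>

definition locally_stable_near ::
  "(real ^ 'n) set \<Rightarrow> (real ^ 'n \<Rightarrow> real ^ 'n) \<Rightarrow> (real ^ 'n) set \<Rightarrow> (real ^ 'n) set \<Rightarrow> bool" where
  "locally_stable_near X f \<O> \<Gamma> \<longleftrightarrow>
     (\<forall>x\<in>\<Gamma>. \<forall>c>0. \<forall>\<epsilon>>0. \<exists>\<delta>>0. \<forall>x0 \<in> set_ball X \<delta> \<Gamma>. \<forall>t>0.
        flow_into X f {0..t} {x0} (ball x c \<inter> X) \<longrightarrow>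
        flow_into X f {0..t} {x0} (set_ball X \<epsilon> \<O>))"

definition locally_uniformly_bounded_near ::
  "(real ^ 'n) set \<Rightarrow> (real ^ 'n \<Rightarrow> real ^ 'n) \<Rightarrow> (real ^ 'n) set \<Rightarrow> bool" where
  "locally_uniformly_bounded_near X f \<Gamma> \<longleftrightarrow>
     (\<forall>x\<in>\<Gamma>. \<exists>l>0. \<exists>m>0. flow_into X f {0..} (ball x l \<inter> X) (ball x m \<inter> X))"

end

theory Submission
  imports Defs
begin

text \<open>Stability is shown at each \<open>x \<in> \<Gamma>\<close> separately: orbits starting near \<open>x\<close> stay in a ball
  around \<open>x\<close> as long as they stay close to \<open>\<Gamma>\<close>, because \<open>\<Gamma>\<close> is bounded or by (iv). Hence all the
  dynamics takes place in a compact set \<open>K = {y \<in> X. \<parallel>y\<parallel>\<^sub>\<Gamma> \<le> \<delta>, dist x y \<le> m}\<close>. Suppose that points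
  \<open>q\<^sub>i \<rightarrow> x\<close> reach \<open>\<parallel>\<cdot>\<parallel>\<^sub>\<Gamma> = \<delta>\<close> at times \<open>T\<^sub>i\<close>. By continuous dependence \<open>T\<^sub>i \<rightarrow> \<infinity>\<close>, and by (ii) the
  orbit segments approach \<open>\<O>\<close>. A limit point \<open>z\<^sub>n \<in> \<O>\<close> of \<open>\<phi>(T\<^sub>i - n, q\<^sub>i)\<close> reaches the level \<open>\<delta>\<close> at time
  \<open>n\<close>, and a limit point \<open>y \<in> \<O>\<close> of the \<open>z\<^sub>n\<close> has its forward orbit in \<open>K\<close>. By relative attractivity the
  orbit of \<open>y\<close> gets close to \<open>\<Gamma>\<close>, hence so does that of \<open>z\<^sub>n\<close> before time \<open>n\<close> for some large \<open>n\<close>, and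
  relative stability keeps it below the level \<open>\<delta>\<close> from then on: a contradiction.

  The phase space enters only through local closedness. On \<open>K\<close> the field is extended to a
  globally Lipschitz field of the ambient space, whose solutions stay in \<open>X\<close> near \<open>K\<close> by
  tangency (Nagumo's argument).\<close>

section \<open>Differential inequalities and Lipschitz fields\<close>

text \<open>Distances along solutions need not be differentiable, so only right increments are
  bounded, up to an arbitrary slack \<open>e\<close>. This serves for the distance of two solutions
  and for the distance of a solution to a set.\<close>

lemma gronwall_dini:
  fixes d :: "real \<Rightarrow> real"
  assumes cont: "continuous_on {0..b} d" and L: "0 \<le> L" and nonneg: "0 \<le> d 0"
    and dini: "\<And>t e. 0 \<le> t \<Longrightarrow> t < b \<Longrightarrow> 0 < e \<Longrightarrow>
      \<exists>\<eta>>0. \<forall>s. t < s \<and> s \<le> b \<and> s - t < \<eta> \<longrightarrow> d s \<le> d t + (s - t) * (L * d t + e)"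
    and t: "0 \<le> t" "t \<le> b"
  shows "d t \<le> d 0 * exp (L * t)"
proof (rule field_le_epsilon)
  \<comment> \<open>Compare with \<open>g s = (d 0 + e * s) * exp (L * s)\<close>, which satisfies
    \<open>g (s + h) \<ge> g s + h * (L * g s + e)\<close>.\<close>
  fix e' :: real assume "0 < e'"
  \<comment> \<open>This size makes the error \<open>e * t * exp (L * t)\<close> at most
    \<open>e'\<close>; the \<open>+ 1\<close> avoids a division by zero at
    \<open>t = 0\<close>.\<close>
  define e where "e = e' / ((t + 1) * exp (L * t))"
  have e: "0 < e" using \<open>0 < e'\<close> t by (simp add: e_def)
  define g where "g s = (d 0 + e * s) * exp (L * s)" for s
  define T where "T = Sup {s \<in> {0..t}. \<forall>r\<in>{0..s}. d r \<le> g r}"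
  let ?S = "{s \<in> {0..t}. \<forall>r\<in>{0..s}. d r \<le> g r}"
  have contt: "continuous_on {0..t} d" using continuous_on_subset[OF cont] t by auto
  have contg: "continuous_on {0..t} g" unfolding g_def by (intro continuous_intros)
  have S0: "0 \<in> ?S" using t by (auto simp: g_def)
  have bdd: "bdd_above ?S" by (auto intro: bdd_aboveI[of _ t])
  have T: "0 \<le> T" "T \<le> t"
    unfolding T_def using S0 bdd by (auto intro!: cSup_upper cSup_least)
  have below: "d r \<le> g r" if "0 \<le> r" "r < T" for r
  proof -
    obtain s where "s \<in> ?S" "r < s"
      using less_cSup_iff[OF _ bdd, of r] S0 \<open>r < T\<close> unfolding T_def by blast
    thus ?thesis using that by auto
  qed
  have dT: "d T \<le> g T"
  proof (cases "T = 0")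
    case True thus ?thesis by (simp add: g_def)
  next
    case False
    have "T \<in> closure {0..<T}" using False T by (simp add: closure_atLeastLessThan)
    moreover have "continuous_on (closure {0..<T}) (\<lambda>r. g r - d r)"
      using False T contt contg
      by (auto intro!: continuous_intros simp: closure_atLeastLessThan intro: continuous_on_subset)
    ultimately have "0 \<le> g T - d T"
      by (intro continuous_ge_on_closure[of "{0..<T}" "\<lambda>r. g r - d r" T 0]) (auto simp: below)
    thus ?thesis by simp
  qed
  \<comment> \<open>Were \<open>T < t\<close>, the increment bound at \<open>T\<close> would carry
    \<open>d \<le> g\<close> beyond the supremum, because
    \<open>1 + L * h \<le> exp (L * h)\<close>.\<close>
  have "T = t"
  proof (rule ccontr)
    assume "T \<noteq> t"
    hence "T < t" using T by simp
    then obtain \<eta> where \<eta>: "\<eta> > 0" and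
      H: "\<And>s. T < s \<Longrightarrow> s \<le> b \<Longrightarrow> s - T < \<eta> \<Longrightarrow> d s \<le> d T + (s - T) * (L * d T + e)"
      using dini[of T e] T t e by auto
    define s where "s = min t (T + \<eta> / 2)"
    have s: "T < s" "s \<le> t" "s - T < \<eta>" using \<eta> \<open>T < t\<close> by (auto simp: s_def min_def)
    have step: "d r \<le> g r" if r: "T < r" "r \<le> s" for r
    proof -
      let ?h = "r - T" and ?A = "d 0 + e * T" and ?E = "exp (L * T)"
      have E1: "1 \<le> ?E" using L T by simp
      have A0: "0 \<le> ?A" using nonneg e T by simp
      have h0: "0 \<le> ?h" using r by simp
      have "d r \<le> d T + ?h * (L * d T + e)" using H r s t by simp
      also have "\<dots> \<le> g T + ?h * (L * g T + e)"
        by (intro add_mono mult_left_mono dT) (use L h0 in auto)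
      also have "\<dots> \<le> g T + ?h * (L * g T + e * ?E)"
        using E1 e h0 by (intro add_left_mono mult_left_mono) auto
      also have "\<dots> = (?A + ?h * (L * ?A + e)) * ?E"
        by (simp add: g_def algebra_simps)
      also have "\<dots> \<le> ((?A + e * ?h) * (1 + L * ?h)) * ?E"
      proof (rule mult_right_mono)
        have "0 \<le> e * L * (?h * ?h)" using e L by simp
        thus "?A + ?h * (L * ?A + e) \<le> (?A + e * ?h) * (1 + L * ?h)"
          by (simp add: algebra_simps)
      qed simp
      also have "\<dots> \<le> ((?A + e * ?h) * exp (L * ?h)) * ?E"
        using A0 e h0 by (intro mult_right_mono mult_left_mono) auto
      also have "\<dots> = g r"
        by (simp add: g_def algebra_simps flip: exp_add)
      finally show ?thesis .
    qed
    have "s \<in> ?S" using s T step below dT by (auto, metis linorder_cases)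
    hence "s \<le> T" unfolding T_def using bdd by (rule cSup_upper)
    thus False using s by simp
  qed
  hence "d t \<le> d 0 * exp (L * t) + e * t * exp (L * t)" using dT by (simp add: g_def algebra_simps)
  also have "e * t * exp (L * t) \<le> e * (t + 1) * exp (L * t)" using e by simp
  also have "\<dots> = e'" using t by (simp add: e_def)
  finally show "d t \<le> d 0 * exp (L * t) + e'" by simp
qed

lemma vector_derivative_remainder:
  assumes "(u has_vector_derivative w) (at t within S)" "0 < e"
  obtains \<eta> where "0 < \<eta>"
    "\<And>s. s \<in> S \<Longrightarrow> \<bar>s - t\<bar> < \<eta> \<Longrightarrow> norm (u s - u t - (s - t) *\<^sub>R w) \<le> e * \<bar>s - t\<bar>"
  using assms unfolding has_vector_derivative_def has_derivative_within_alt by fastforce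

text \<open>Equal initial values give uniqueness, distinct ones continuous dependence. The set
  \<open>S\<close> only has to contain both curves, so a compact set of orbit points serves as well
  as the whole space.\<close>

lemma solutions_dist_le:
  fixes u v :: "real \<Rightarrow> 'a::real_normed_vector"
  assumes F: "L-lipschitz_on S F"
    and u: "\<And>t. t \<in> {0..b} \<Longrightarrow> u t \<in> S \<and> (u has_vector_derivative F (u t)) (at t within {0..b})"
    and v: "\<And>t. t \<in> {0..b} \<Longrightarrow> v t \<in> S \<and> (v has_vector_derivative F (v t)) (at t within {0..b})"
    and t: "t \<in> {0..b}"
  shows "dist (u t) (v t) \<le> dist (u 0) (v 0) * exp (L * t)"
proof (rule gronwall_dini[where d = "\<lambda>t. dist (u t) (v t)" and b = b])
  show "continuous_on {0..b} (\<lambda>t. dist (u t) (v t))"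
    using u v by (intro continuous_on_dist continuous_on_vector_derivative) auto
  show "0 \<le> L" using F by (rule lipschitz_on_nonneg)
  fix t e :: real assume te: "0 \<le> t" "t < b" "0 < e"
  have "((\<lambda>s. u s - v s) has_vector_derivative (F (u t) - F (v t))) (at t within {0..b})"
    using u v te by (intro has_vector_derivative_diff) auto
  from vector_derivative_remainder[OF this te(3)] obtain \<eta> where \<eta>: "0 < \<eta>" and
    R: "\<And>s. s \<in> {0..b} \<Longrightarrow> \<bar>s - t\<bar> < \<eta> \<Longrightarrow>
      norm (u s - v s - (u t - v t) - (s - t) *\<^sub>R (F (u t) - F (v t))) \<le> e * \<bar>s - t\<bar>"
    by blast
  have "dist (u s) (v s) \<le> dist (u t) (v t) + (s - t) * (L * dist (u t) (v t) + e)"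
    if s: "t < s" "s \<le> b" "s - t < \<eta>" for s
  proof -
    have "norm (F (u t) - F (v t)) \<le> L * dist (u t) (v t)"
      using lipschitz_onD[OF F] u v te by (simp add: dist_norm)
    hence "(s - t) * norm (F (u t) - F (v t)) \<le> (s - t) * (L * dist (u t) (v t))"
      using s by (intro mult_left_mono) auto
    moreover have "norm (u s - v s) \<le> norm (u t - v t) + norm ((s - t) *\<^sub>R (F (u t) - F (v t)))
        + norm (u s - v s - (u t - v t) - (s - t) *\<^sub>R (F (u t) - F (v t)))"
      by (rule order_trans[OF _ order_trans[OF norm_triangle_ineq add_right_mono[OF norm_triangle_ineq]]]) simp
    moreover have "norm (u s - v s - (u t - v t) - (s - t) *\<^sub>R (F (u t) - F (v t))) \<le> e * (s - t)"
      using R[of s] s te by simp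
    moreover have "norm ((s - t) *\<^sub>R (F (u t) - F (v t))) = (s - t) * norm (F (u t) - F (v t))"
      using s by simp
    ultimately show ?thesis
      unfolding dist_norm distrib_left mult.commute[of e] by linarith
  qed
  thus "\<exists>\<eta>>0. \<forall>s. t < s \<and> s \<le> b \<and> s - t < \<eta> \<longrightarrow>
      dist (u s) (v s) \<le> dist (u t) (v t) + (s - t) * (L * dist (u t) (v t) + e)"
    using \<eta> by blast
qed (use t in auto)

text \<open>McShane's formula.\<close>

lemma lipschitz_extension_real:
  fixes g :: "'a::metric_space \<Rightarrow> real"
  assumes g: "L-lipschitz_on K g" and K: "K \<noteq> {}"
  obtains h where "L-lipschitz_on UNIV h" "\<And>x. x \<in> K \<Longrightarrow> h x = g x"
proof
  define h where "h x = (INF y\<in>K. g y + L * dist x y)" for x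
  have L: "0 \<le> L" using g by (rule lipschitz_on_nonneg)
  obtain y0 where y0: "y0 \<in> K" using K by blast
  have lower: "g z - L * dist x z \<le> g y + L * dist x y" if "y \<in> K" "z \<in> K" for x y z
  proof -
    have "g z - g y \<le> L * dist z y" using lipschitz_onD[OF g that(2,1)] by (simp add: dist_real_def)
    also have "\<dots> \<le> L * (dist x z + dist x y)"
      using L by (intro mult_left_mono) (metis dist_commute dist_triangle)+
    finally show ?thesis by (simp add: algebra_simps)
  qed
  have bdd: "bdd_below ((\<lambda>y. g y + L * dist x y) ` K)" for x
    by (rule bdd_belowI2[of _ "g y0 - L * dist x y0"]) (rule lower[OF _ y0])
  have *: "h x \<le> h z + L * dist x z" for x z
  proof -
    have "h x - L * dist x z \<le> g y + L * dist z y" if "y \<in> K" for y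
    proof -
      have "h x \<le> g y + L * dist x y" unfolding h_def by (rule cINF_lower[OF bdd that])
      also have "\<dots> \<le> g y + L * (dist x z + dist z y)"
        using L by (intro add_left_mono mult_left_mono dist_triangle)
      finally show ?thesis by (simp add: algebra_simps)
    qed
    hence "h x - L * dist x z \<le> h z" unfolding h_def[of z] by (intro cINF_greatest K)
    thus ?thesis by simp
  qed
  show "L-lipschitz_on UNIV h"
    by (rule lipschitz_onI[OF _ L]) (use * in \<open>fastforce simp: dist_real_def dist_commute abs_le_iff algebra_simps\<close>)
  show "h x = g x" if "x \<in> K" for x
  proof (rule antisym)
    show "h x \<le> g x" unfolding h_def using cINF_lower[OF bdd that, of x] by simp
    show "g x \<le> h x" unfolding h_def using lower[OF _ that, of _ x] K by (intro cINF_greatest) auto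
  qed
qed

text \<open>Each coordinate is extended separately; passing through the l1 norm costs a factor equal
  to the dimension.\<close>

lemma lipschitz_extension:
  fixes f :: "'a::metric_space \<Rightarrow> real ^ 'n"
  assumes f: "L-lipschitz_on K f" and K: "K \<noteq> {}"
  obtains M F where "M-lipschitz_on UNIV F" "\<And>x. x \<in> K \<Longrightarrow> F x = f x"
proof -
  have L: "0 \<le> L" using f by (rule lipschitz_on_nonneg)
  have "L-lipschitz_on K (\<lambda>x. f x $ i)" for i
    by (rule lipschitz_onI[OF _ L])
       (meson dist_vec_nth_le lipschitz_onD[OF f] order_trans)
  hence "\<exists>h. L-lipschitz_on UNIV h \<and> (\<forall>x\<in>K. h x = f x $ i)" for i
    by (rule lipschitz_extension_real[OF _ K]) blast
  then obtain h where h: "\<And>i. L-lipschitz_on UNIV (h i)" "\<And>i x. x \<in> K \<Longrightarrow> h i x = f x $ i"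
    by metis
  have F: "(of_nat CARD('n) * L)-lipschitz_on UNIV (\<lambda>x. \<chi> i. h i x)"
  proof (rule lipschitz_onI)
    fix x y
    have "dist (\<chi> i. h i x) (\<chi> i. h i y) \<le> (\<Sum>i\<in>UNIV. \<bar>h i x - h i y\<bar>)"
      unfolding dist_norm by (rule order_trans[OF norm_le_l1_cart]) simp
    also have "\<dots> \<le> (\<Sum>i\<in>(UNIV::'n set). L * dist x y)"
      by (intro sum_mono) (use lipschitz_onD[OF h(1)] in \<open>auto simp: dist_real_def\<close>)
    finally show "dist (\<chi> i. h i x) (\<chi> i. h i y) \<le> of_nat CARD('n) * L * dist x y" by simp
  qed (use L in auto)
  show thesis by (rule that[OF F]) (simp add: vec_eq_iff h(2))
qed

section \<open>Global existence for Lipschitz fields\<close>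

text \<open>The factor \<open>1 / c\<close> gained over the pointwise bound is what makes the Picard
  operator contract in the weighted norm.\<close>

lemma norm_integral_le_exp:
  fixes g :: "real \<Rightarrow> 'a::banach"
  assumes g: "continuous_on {0..t} g" and c: "0 < c" and t: "0 \<le> t" and M: "0 \<le> M"
    and bound: "\<And>s. s \<in> {0..t} \<Longrightarrow> norm (g s) \<le> M * exp (c * s)"
  shows "norm (integral {0..t} g) \<le> M / c * exp (c * t)"
proof -
  have "((\<lambda>s. M * exp (c * s)) has_integral (M / c * exp (c * t) - M / c * exp (c * 0))) {0..t}"
    using t c by (intro fundamental_theorem_of_calculus)
      (auto intro!: derivative_eq_intros simp flip: has_real_derivative_iff_has_vector_derivative)
  note I = this
  have "norm (integral {0..t} g) \<le> integral {0..t} (\<lambda>s. M * exp (c * s))"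
    by (intro integral_norm_bound_integral integrable_continuous_real g bound continuous_intros)
  also have "\<dots> = M / c * exp (c * t) - M / c * exp (c * 0)" by (rule integral_unique[OF I])
  also have "\<dots> \<le> M / c * exp (c * t)" using M c by simp
  finally show ?thesis .
qed

text \<open>The Picard operator is a contraction for the norm \<open>sup\<^sub>t exp (- c t) |u t|\<close> with
  \<open>c > L\<close>, which yields the solution on all of \<open>[0, \<infinity>)\<close> at once.\<close>

lemma lipschitz_global_solution:
  fixes F :: "'a::banach \<Rightarrow> 'a"
  assumes F: "L-lipschitz_on UNIV F"
  obtains u where "u 0 = x"
    "\<And>t. 0 \<le> t \<Longrightarrow> (u has_vector_derivative F (u t)) (at t within {0..})"
proof -
  have L: "0 \<le> L" using F by (rule lipschitz_on_nonneg)
  have contF: "continuous_on UNIV F" using F by (rule lipschitz_on_continuous_on)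
  \<comment> \<open>The contraction ratio \<open>L / c\<close> is then below 1/2, and
    \<open>c\<close> is positive even for \<open>L = 0\<close>.\<close>
  define c where "c = 2 * L + 1"
  have c: "0 < c" using L by (simp add: c_def)
  define h where "h v s = F (exp (c * s) *\<^sub>R apply_bcontfun v s)" for v s
  define G where "G v t = x + integral {0..t} (h v)" for v t
  \<comment> \<open>The fixed point will be the weighted curve
    \<open>exp (- c * t) *\<^sub>R u t\<close>. With \<open>max 0 t\<close> it is frozen at negative
    times, so that bounded continuous functions on the whole line can be used.\<close>
  define Q where "Q v t = exp (- c * max 0 t) *\<^sub>R G v (max 0 t)" for v t
  have conth: "continuous_on S (h v)" for v S
    unfolding h_def by (intro continuous_on_compose2[OF contF] continuous_intros) auto
  have deriv: "(G v has_vector_derivative h v t) (at t within {0..})" if "0 \<le> t" for v t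
  proof -
    have "(G v has_vector_derivative h v t) (at t within {0..t+1})"
      unfolding G_def using integral_has_vector_derivative[OF conth, of t 0 "t+1" v] that
      by (auto intro!: derivative_eq_intros)
    moreover have "at t within {0..t+1} = at t within {0..}"
      using that by (intro at_within_nhd[of _ "{..<t+1}"]) auto
    ultimately show ?thesis by simp
  qed
  have contG: "continuous_on {0..} (G v)" for v
    using deriv by (intro continuous_on_vector_derivative) auto
  have Q: "Q v \<in> bcontfun" for v
  proof -
    have "continuous_on UNIV (Q v)"
      unfolding Q_def by (intro continuous_intros continuous_on_compose2[OF contG]) auto
    moreover have "norm (Q v t) \<le> norm x + (norm (F 0) + L * dist v 0) / c" for t
    proof -
      let ?t = "max 0 t" and ?M = "norm (F 0) + L * dist v 0"
      have "norm (h v s) \<le> ?M * exp (c * s)" if "s \<in> {0..?t}" for s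
      proof -
        have "norm (h v s) \<le> norm (F 0) + dist (h v s) (F 0)"
          by (simp add: dist_norm norm_triangle_sub)
        also have "\<dots> \<le> norm (F 0) + L * (exp (c * s) * norm (v s))"
          using lipschitz_onD[OF F, of "exp (c * s) *\<^sub>R v s" 0] by (simp add: h_def)
        also have "\<dots> \<le> norm (F 0) * exp (c * s) + L * (exp (c * s) * dist v 0)"
          using that c L dist_bounded[of v s 0]
          by (intro add_mono mult_left_mono) (auto simp: mult_le_cancel_left1)
        finally show ?thesis by (simp add: algebra_simps)
      qed
      hence "norm (integral {0..?t} (h v)) \<le> ?M / c * exp (c * ?t)"
        by (intro norm_integral_le_exp conth c) (use L in auto)
      hence "norm (G v ?t) \<le> norm x * exp (c * ?t) + ?M / c * exp (c * ?t)"
        unfolding G_def using c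
        by (intro order_trans[OF norm_triangle_ineq] add_mono) (auto simp: mult_le_cancel_left1)
      hence "exp (- c * ?t) * norm (G v ?t) \<le> exp (- c * ?t) * ((norm x + ?M / c) * exp (c * ?t))"
        by (intro mult_left_mono) (auto simp: algebra_simps)
      also have "\<dots> = norm x + ?M / c" by (simp add: exp_minus)
      finally show ?thesis by (simp add: Q_def)
    qed
    ultimately show ?thesis unfolding bcontfun_def by (auto intro: boundedI)
  qed
  define P where "P v = Bcontfun (Q v)" for v
  have P: "apply_bcontfun (P v) t = Q v t" for v t
    using Q by (simp add: P_def Bcontfun_inverse)
  have "dist (P v) (P w) \<le> L / c * dist v w" for v w
  proof (rule dist_bound)
    fix t :: real
    let ?t = "max 0 t"
    have "norm (h v s - h w s) \<le> L * dist v w * exp (c * s)" for s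
    proof -
      have "norm (h v s - h w s) \<le> L * (exp (c * s) * dist (v s) (w s))"
        using lipschitz_onD[OF F, of "exp (c * s) *\<^sub>R v s" "exp (c * s) *\<^sub>R w s"]
        by (simp add: h_def dist_norm flip: scaleR_diff_right)
      also have "\<dots> \<le> L * (exp (c * s) * dist v w)"
        using L dist_bounded[of v s w] by (intro mult_left_mono) auto
      finally show ?thesis by (simp add: algebra_simps)
    qed
    hence "norm (integral {0..?t} (\<lambda>s. h v s - h w s)) \<le> L * dist v w / c * exp (c * ?t)"
      by (intro norm_integral_le_exp continuous_intros conth c) (use L in auto)
    moreover have "integral {0..?t} (\<lambda>s. h v s - h w s) = G v ?t - G w ?t"
      by (simp add: G_def integral_diff integrable_continuous_real[OF conth])
    ultimately have "exp (- c * ?t) * norm (G v ?t - G w ?t)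
        \<le> exp (- c * ?t) * (L * dist v w / c * exp (c * ?t))"
      by (intro mult_left_mono) auto
    also have "\<dots> = L / c * dist v w" by (simp add: exp_minus)
    finally show "dist (P v t) (P w t) \<le> L / c * dist v w"
      by (simp add: P Q_def dist_norm flip: scaleR_diff_right)
  qed
  hence "\<exists>!v. P v = v"
    using L by (intro banach_fix_type[of "L / c"]) (auto simp: c_def)
  then obtain v where v: "P v = v" by blast
  define u where "u t = exp (c * t) *\<^sub>R apply_bcontfun v t" for t
  have u: "u t = G v t" if "0 \<le> t" for t
    using that P[of v t] by (simp add: u_def v Q_def exp_minus)
  have "(u has_vector_derivative F (u t)) (at t within {0..})" if "0 \<le> t" for t
    using deriv[OF that, of v] that
    by (intro has_vector_derivative_transform[OF _ _ deriv[OF that, of v, unfolded h_def, folded u_def]])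
       (auto simp: u)
  thus thesis using that[of u] u[of 0] by (simp add: G_def)
qed

section \<open>Solutions and flows on the phase space\<close>

text \<open>Of the curve defining a tangent vector, Nagumo's argument uses just this one-sided
  first-order approximation by points of \<open>X\<close>.\<close>

lemma tangent_space_approx:
  assumes v: "v \<in> tangent_space X y" and e: "0 < e"
  obtains \<eta> where "0 < \<eta>"
    "\<And>h. 0 < h \<Longrightarrow> h < \<eta> \<Longrightarrow> \<exists>z\<in>X. norm (z - y - h *\<^sub>R v) \<le> e * h"
proof -
  obtain \<gamma> a where a: "0 < a" and \<gamma>: "\<gamma> ` {-a<..<a} \<subseteq> X" "\<gamma> (0::real) = y"
    and der: "(\<gamma> has_vector_derivative v) (at 0)"
    using v unfolding tangent_space_def by blast
  obtain \<eta> where \<eta>: "0 < \<eta>"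
    and R: "\<And>s. \<bar>s\<bar> < \<eta> \<Longrightarrow> norm (\<gamma> s - y - s *\<^sub>R v) \<le> e * \<bar>s\<bar>"
    using vector_derivative_remainder[OF der e] \<gamma>(2) by auto
  show thesis
  proof (rule that[of "min a \<eta>"])
    fix h :: real assume h: "0 < h" "h < min a \<eta>"
    have "\<gamma> h \<in> X" using h a \<gamma>(1) by (auto simp: image_subset_iff)
    thus "\<exists>z\<in>X. norm (z - y - h *\<^sub>R v) \<le> e * h" using R[of h] h by auto
  qed (use a \<eta> in auto)
qed

text \<open>Nagumo's argument: if \<open>y\<close> is a point of \<open>K\<close> nearest to \<open>u t\<close>, comparing \<open>u (t + h)\<close> with the
  point at time \<open>h\<close> of a curve in \<open>X\<close> through \<open>y\<close> with velocity \<open>F y\<close> bounds the Dini derivative of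
  \<open>infdist (u t) K\<close> by \<open>L * infdist (u t) K\<close>.\<close>

lemma tangent_solution_stays:
  fixes F :: "real ^ 'n \<Rightarrow> real ^ 'n"
  assumes F: "L-lipschitz_on UNIV F"
    and K: "compact K" "K \<subseteq> X" and tang: "\<And>y. y \<in> K \<Longrightarrow> F y \<in> tangent_space X y"
    and G: "openin (top_of_set X) G" "G \<subseteq> K" "u 0 \<in> G"
    and u: "\<And>t. t \<in> {0..b} \<Longrightarrow> (u has_vector_derivative F (u t)) (at t within {0..b})"
    and b: "0 < b"
  obtains h where "0 < h" "h \<le> b" "\<And>t. t \<in> {0..h} \<Longrightarrow> u t \<in> G"
proof -
  have L: "0 \<le> L" using F by (rule lipschitz_on_nonneg)
  have contu: "continuous_on {0..b} u" using u by (intro continuous_on_vector_derivative) auto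
  obtain r0 where r0: "0 < r0" "ball (u 0) r0 \<inter> X \<subseteq> G"
    using G by (meson openin_contains_ball)
  \<comment> \<open>Thirds, because distances from \<open>u 0\<close> add up: \<open>u t\<close> is
    within \<open>r\<close>, its nearest point \<open>y\<close> in \<open>K\<close> within
    \<open>2 * r\<close>, and the approximating point \<open>z\<close> of \<open>X\<close> within
    \<open>3 * r\<close>.\<close>
  define r where "r = r0 / 3"
  have r: "0 < r" and rG: "\<And>z. z \<in> X \<Longrightarrow> dist (u 0) z < 3 * r \<Longrightarrow> z \<in> G"
    using r0 by (auto simp: r_def)
  obtain h0 where h0: "0 < h0" "\<And>t. t \<in> {0..b} \<Longrightarrow> dist t 0 < h0 \<Longrightarrow> dist (u t) (u 0) < r"
    using contu r b unfolding continuous_on_iff by (meson atLeastAtMost_iff less_imp_le order_refl)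
  define h where "h = min b (h0 / 2)"
  have h: "0 < h" "h \<le> b" using b h0(1) by (auto simp: h_def)
  have near: "dist (u t) (u 0) < r" if "t \<in> {0..h}" for t
    using h0 that by (auto simp: h_def dist_real_def)
  have Kne: "K \<noteq> {}" and Kc: "closed K" using G K by (auto simp: compact_imp_closed)
  have "infdist (u t) K \<le> infdist (u 0) K * exp (L * t)" if "t \<in> {0..h}" for t
  proof (rule gronwall_dini[where d = "\<lambda>t. infdist (u t) K" and b = h])
    show "continuous_on {0..h} (\<lambda>t. infdist (u t) K)"
      using h by (intro continuous_on_infdist continuous_on_subset[OF contu]) auto
    fix t e :: real assume te: "0 \<le> t" "t < h" "0 < e"
    obtain y where y: "y \<in> K" "infdist (u t) K = dist (u t) y"
      using infdist_attains_inf[OF Kc Kne] by blast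
    have "dist (u t) y \<le> dist (u t) (u 0)"
      using infdist_le[of "u 0" K "u t"] G y(2) by auto
    hence yr: "dist (u 0) y < 2 * r"
      using near[of t] te dist_triangle2[of "u 0" y "u t"] by (simp add: dist_commute)
    obtain \<eta>1 where \<eta>1: "0 < \<eta>1" and Z: "\<And>k. 0 < k \<Longrightarrow> k < \<eta>1 \<Longrightarrow>
        \<exists>z\<in>X. norm (z - y - k *\<^sub>R F y) \<le> e / 2 * k"
      using tangent_space_approx[OF tang[OF y(1)], of "e / 2"] te by auto
    obtain \<eta>2 where \<eta>2: "0 < \<eta>2" and R: "\<And>s. s \<in> {0..b} \<Longrightarrow> \<bar>s - t\<bar> < \<eta>2 \<Longrightarrow>
        norm (u s - u t - (s - t) *\<^sub>R F (u t)) \<le> e / 2 * \<bar>s - t\<bar>"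
      using vector_derivative_remainder[OF u[of t], of "e / 2"] te h by auto
    \<comment> \<open>Before time \<open>\<eta>3\<close> the approximating point moves less than
      \<open>r\<close> away from \<open>y\<close>; hence it lies in \<open>K\<close>, and its
      distance to \<open>u s\<close> bounds \<open>infdist (u s) K\<close>.\<close>
    define \<eta>3 where "\<eta>3 = r / (norm (F y) + e)"
    have pos: "0 < norm (F y) + e" using te by (simp add: add_nonneg_pos)
    have \<eta>3: "0 < \<eta>3" using r pos by (simp add: \<eta>3_def)
    have "infdist (u s) K \<le> infdist (u t) K + (s - t) * (L * infdist (u t) K + e)"
      if s: "t < s" "s \<le> h" "s - t < min \<eta>1 (min \<eta>2 \<eta>3)" for s
    proof -
      define k where "k = s - t"
      have k: "0 < k" "k < \<eta>1" "k < \<eta>2" "k < \<eta>3" using s by (auto simp: k_def)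
      obtain z where z: "z \<in> X" "norm (z - y - k *\<^sub>R F y) \<le> e / 2 * k" using Z k by blast
      have "dist y z \<le> norm (k *\<^sub>R F y) + norm (z - y - k *\<^sub>R F y)"
        using norm_triangle_ineq[of "k *\<^sub>R F y" "z - y - k *\<^sub>R F y"]
        by (simp add: dist_norm norm_minus_commute)
      also have "\<dots> \<le> k * (norm (F y) + e)"
        using z(2) k mult_pos_pos[OF te(3) k(1)] by (simp add: distrib_left mult.commute)
      also have "\<dots> < r" using k(4) pos by (simp add: \<eta>3_def pos_less_divide_eq)
      finally have "z \<in> K"
        using rG[OF z(1)] yr G(2) dist_triangle[of "u 0" z y] by force
      hence "infdist (u s) K \<le> dist (u s) z" by (rule infdist_le)
      also have "\<dots> = norm ((u s - u t - k *\<^sub>R F (u t)) + (u t - y) + k *\<^sub>R (F (u t) - F y)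
          - (z - y - k *\<^sub>R F y))"
        by (simp add: dist_norm algebra_simps)
      also have "\<dots> \<le> norm (u s - u t - k *\<^sub>R F (u t)) + norm (u t - y)
          + norm (k *\<^sub>R (F (u t) - F y)) + norm (z - y - k *\<^sub>R F y)"
        by (intro order_trans[OF norm_triangle_ineq4] add_right_mono
            order_trans[OF norm_triangle_ineq] order_refl)
      also have "\<dots> \<le> e / 2 * k + dist (u t) y + k * (L * dist (u t) y) + e / 2 * k"
      proof (intro add_mono z(2))
        show "norm (u s - u t - k *\<^sub>R F (u t)) \<le> e / 2 * k"
          using R[of s] s te h k by (simp add: k_def)
        show "norm (k *\<^sub>R (F (u t) - F y)) \<le> k * (L * dist (u t) y)"
          using k lipschitz_onD[OF F, of "u t" y] by (simp add: dist_norm)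
      qed (simp add: dist_norm)
      finally show ?thesis by (simp add: y(2) k_def algebra_simps)
    qed
    thus "\<exists>\<eta>>0. \<forall>s. t < s \<and> s \<le> h \<and> s - t < \<eta> \<longrightarrow>
        infdist (u s) K \<le> infdist (u t) K + (s - t) * (L * infdist (u t) K + e)"
      using \<eta>1 \<eta>2 \<eta>3 by (intro exI[of _ "min \<eta>1 (min \<eta>2 \<eta>3)"]) auto
  qed (use that L infdist_nonneg in auto)
  moreover have "infdist (u 0) K = 0" using G by auto
  ultimately have "u t \<in> K" if "t \<in> {0..h}" for t
    using that infdist_nonneg[of "u t" K] in_closed_iff_infdist_zero[OF Kc Kne] by fastforce
  hence "u t \<in> G" if "t \<in> {0..h}" for t
    using that near[OF that] r K(2) by (intro rG) (auto simp: dist_commute)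
  thus thesis using that h by blast
qed

section \<open>Uniqueness of solutions and values of the flow\<close>

lemma ode_solution_restrict:
  assumes "ode_solution X f I x u" "0 \<le> t" "t \<in> I"
  shows "ode_solution X f {0..t} x u"
proof -
  have "{0..t} \<subseteq> I"
    using assms unfolding ode_solution_def is_interval_1 by auto
  thus ?thesis
    using assms unfolding ode_solution_def
    by (auto intro: has_vector_derivative_within_subset simp: is_interval_cc)
qed

lemma local_lipschitz_compact:
  assumes "local_lipschitz (UNIV :: real set) X (\<lambda>_. f)" "compact K" "K \<subseteq> X"
  obtains L where "L-lipschitz_on K f"
proof -
  have "local_lipschitz {0::real} K (\<lambda>_. f)"
    using assms by (blast intro: local_lipschitz_subset)
  from local_lipschitz_compact_implies_lipschitz[OF this assms(2)] that show thesis by force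
qed

text \<open>The ranges of both solutions over \<open>{0..t}\<close> form a compact subset of
  \<open>X\<close>, on which the locally Lipschitz field has a single Lipschitz constant.\<close>

lemma ode_solution_unique:
  fixes X :: "(real ^ 'n) set"
  assumes f: "local_lipschitz (UNIV :: real set) X (\<lambda>_. f)"
    and u: "ode_solution X f I x u" "t \<in> I" and v: "ode_solution X f J x v" "t \<in> J" and t: "0 \<le> t"
  shows "u t = v t"
proof -
  note uv = ode_solution_restrict[OF u(1) t u(2)] ode_solution_restrict[OF v(1) t v(2)]
  define K where "K = u ` {0..t} \<union> v ` {0..t}"
  have "continuous_on {0..t} u" "continuous_on {0..t} v"
    using uv unfolding ode_solution_def by (auto intro: continuous_on_vector_derivative)
  hence "compact K" unfolding K_def by (intro compact_Un compact_continuous_image) auto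
  moreover have "K \<subseteq> X" using uv unfolding ode_solution_def K_def by auto
  ultimately obtain L where "L-lipschitz_on K f" using local_lipschitz_compact[OF f] by blast
  from solutions_dist_le[OF this, of t u v t] uv t have "dist (u t) (v t) \<le> dist (u 0) (v 0) * exp (L * t)"
    unfolding ode_solution_def K_def by auto
  thus ?thesis using uv unfolding ode_solution_def by auto
qed

lemma flow_eq:
  fixes X :: "(real ^ 'n) set"
  assumes f: "local_lipschitz (UNIV :: real set) X (\<lambda>_. f)"
    and u: "ode_solution X f I x u" "t \<in> I" and t: "0 \<le> t"
  shows "flow X f t x = u t"
  unfolding flow_def
proof (rule the_equality)
  show "\<exists>I v. t \<in> I \<and> ode_solution X f I x v \<and> v t = u t" using u by blast
  fix y assume "\<exists>I v. t \<in> I \<and> ode_solution X f I x v \<and> v t = y"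
  thus "y = u t" using ode_solution_unique[OF f _ _ u t] by blast
qed

lemma flow_solution:
  fixes X :: "(real ^ 'n) set"
  assumes f: "local_lipschitz (UNIV :: real set) X (\<lambda>_. f)"
    and t: "t \<in> existence_interval X f x" "0 \<le> t"
  shows "ode_solution X f {0..t} x (\<lambda>s. flow X f s x)"
proof -
  obtain I u where u: "t \<in> I" "ode_solution X f I x u"
    using t unfolding existence_interval_def by blast
  note v = ode_solution_restrict[OF u(2) t(2) u(1)]
  have eq: "flow X f s x = u s" if "s \<in> {0..t}" for s
    using flow_eq[OF f v that] that by simp
  have "((\<lambda>s. flow X f s x) has_vector_derivative f (flow X f s x)) (at s within {0..t})"
    if s: "s \<in> {0..t}" for s
    using v s unfolding ode_solution_def
    by (intro has_vector_derivative_transform[OF s eq]) (auto simp: eq[OF s])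
  thus ?thesis using v t eq unfolding ode_solution_def by auto
qed

lemma ode_solution_existence:
  "ode_solution X f I x u \<Longrightarrow> t \<in> I \<Longrightarrow> t \<in> existence_interval X f x"
  unfolding existence_interval_def by blast

section \<open>The semiflow of the extended field\<close>

text \<open>\<open>\<Phi>\<close> is defined for all forward times and depends continuously on the
  initial point, whereas \<open>flow\<close> is meaningful only on existence intervals. As long as
  an orbit of \<open>\<Phi>\<close> stays in \<open>K\<close>, it solves the equation of
  \<open>f\<close>.\<close>

locale lipschitz_extended_field =
  fixes X K :: "(real ^ 'n) set" and f F :: "real ^ 'n \<Rightarrow> real ^ 'n" and L :: real
    and \<Phi> :: "real \<Rightarrow> real ^ 'n \<Rightarrow> real ^ 'n"
  assumes lipschitz: "local_lipschitz (UNIV :: real set) X (\<lambda>_. f)"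
    and tangent: "x \<in> X \<Longrightarrow> f x \<in> tangent_space X x"
    and K: "compact K" "K \<subseteq> X"
    and F: "L-lipschitz_on UNIV F" "x \<in> K \<Longrightarrow> F x = f x"
    and \<Phi>_0 [simp]: "\<Phi> 0 x = x"
    and \<Phi>: "0 \<le> t \<Longrightarrow> ((\<lambda>t. \<Phi> t x) has_vector_derivative F (\<Phi> t x)) (at t within {0..})"
begin

lemma \<Phi>_within: "t \<in> {0..b} \<Longrightarrow> ((\<lambda>t. \<Phi> t x) has_vector_derivative F (\<Phi> t x)) (at t within {0..b})"
  by (rule has_vector_derivative_within_subset[OF \<Phi>]) auto

lemma \<Phi>_shift:
  assumes "0 \<le> a" "t \<in> {0..b}"
  shows "((\<lambda>t. \<Phi> (a + t) x) has_vector_derivative F (\<Phi> (a + t) x)) (at t within {0..b})"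
proof -
  have "((\<lambda>t. \<Phi> t x) has_vector_derivative F (\<Phi> (a + t) x)) (at (a + t) within (\<lambda>s. a + s) ` {0..b})"
    by (rule has_vector_derivative_within_subset[OF \<Phi>]) (use assms in auto)
  moreover have "((\<lambda>s. a + s) has_vector_derivative 1) (at t within {0..b})"
    by (auto intro!: derivative_eq_intros)
  ultimately show ?thesis
    using vector_diff_chain_within[of "\<lambda>s. a + s" 1 t _ "\<lambda>t. \<Phi> t x"] by (simp add: o_def)
qed

lemma \<Phi>_dist: "0 \<le> t \<Longrightarrow> dist (\<Phi> t x) (\<Phi> t y) \<le> dist x y * exp (L * t)"
  using solutions_dist_le[OF F(1), of t "\<lambda>t. \<Phi> t x" "\<lambda>t. \<Phi> t y" t] by (simp add: \<Phi>_within)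

lemma \<Phi>_add:
  assumes "0 \<le> a" "0 \<le> t"
  shows "\<Phi> (a + t) x = \<Phi> t (\<Phi> a x)"
  using solutions_dist_le[OF F(1), of t "\<lambda>t. \<Phi> (a + t) x" "\<lambda>t. \<Phi> t (\<Phi> a x)" t] assms
  by (simp add: \<Phi>_within \<Phi>_shift)

lemma \<Phi>_continuous: "continuous_on {0..b} (\<lambda>t. \<Phi> t x)"
  by (rule continuous_on_vector_derivative) (rule \<Phi>_within)

lemma \<Phi>_tendsto:
  assumes "0 \<le> t" "(y \<longlongrightarrow> x) A"
  shows "((\<lambda>i. \<Phi> t (y i)) \<longlongrightarrow> \<Phi> t x) A"
proof -
  have "((\<lambda>i. dist (y i) x * exp (L * t)) \<longlongrightarrow> 0 * exp (L * t)) A"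
    using assms(2) by (intro tendsto_intros) (simp add: tendsto_dist_iff[symmetric])
  hence "((\<lambda>i. dist (\<Phi> t (y i)) (\<Phi> t x)) \<longlongrightarrow> 0) A"
    by (intro Lim_null_comparison[of "\<lambda>i. dist (\<Phi> t (y i)) (\<Phi> t x)" "\<lambda>i. dist (y i) x * exp (L * t)"])
       (auto simp: \<Phi>_dist assms(1))
  thus ?thesis by (simp add: tendsto_dist_iff[symmetric])
qed

lemma \<Phi>_solution:
  assumes "\<And>s. s \<in> {0..t} \<Longrightarrow> \<Phi> s x \<in> K" "0 \<le> t"
  shows "ode_solution X f {0..t} x (\<lambda>s. \<Phi> s x)"
  unfolding ode_solution_def
proof (intro conjI ballI)
  fix s assume s: "s \<in> {0..t}"
  show "\<Phi> s x \<in> X" using assms(1)[OF s] K by auto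
  show "((\<lambda>s. \<Phi> s x) has_vector_derivative f (\<Phi> s x)) (at s within {0..t})"
    using \<Phi>_within[OF s] F(2)[OF assms(1)[OF s]] by metis
qed (use assms in \<open>auto simp: is_interval_cc\<close>)

lemma flow_eq_\<Phi>:
  assumes "\<And>s. s \<in> {0..t} \<Longrightarrow> \<Phi> s x \<in> K" "0 \<le> t"
  shows "t \<in> existence_interval X f x" "flow X f t x = \<Phi> t x"
  using ode_solution_existence[OF \<Phi>_solution[OF assms]]
    flow_eq[OF lipschitz \<Phi>_solution[OF assms]] assms(2) by auto

lemma solution_eq_\<Phi>:
  assumes u: "ode_solution X f {0..t} x u" and uK: "\<And>s. s \<in> {0..t} \<Longrightarrow> u s \<in> K" and s: "s \<in> {0..t}"
  shows "u s = \<Phi> s x"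
proof -
  have u': "(u has_vector_derivative F (u r)) (at r within {0..t})" if "r \<in> {0..t}" for r
    using u uK[OF that] that F(2) unfolding ode_solution_def by auto
  have "u 0 = x" using u by (simp add: ode_solution_def)
  thus ?thesis
    using solutions_dist_le[OF F(1), of t u "\<lambda>t. \<Phi> t x" s] s by (simp add: u' \<Phi>_within)
qed

text \<open>Since \<open>G\<close> is open only in \<open>X\<close>, a trajectory of
  \<open>F\<close> could a priori leave \<open>G\<close> by departing from \<open>X\<close>.
  Tangency rules this out, so the infimum of the exit times is itself an exit time, and the orbit is
  still in the closed set \<open>K\<close> then.\<close>

lemma first_exit:
  assumes G: "openin (top_of_set X) G" "G \<subseteq> K" "x \<in> G" and t: "0 \<le> t" "\<Phi> t x \<notin> G"
  obtains T where "0 \<le> T" "\<Phi> T x \<notin> G" "\<And>s. s \<in> {0..T} \<Longrightarrow> \<Phi> s x \<in> K"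
proof -
  define T where "T = Inf {t. 0 \<le> t \<and> \<Phi> t x \<notin> G}"
  let ?S = "{t. 0 \<le> t \<and> \<Phi> t x \<notin> G}"
  have ne: "t \<in> ?S" using t by simp
  have bdd: "bdd_below ?S" by (rule bdd_belowI[of _ 0]) auto
  have T0: "0 \<le> T" unfolding T_def using ne by (intro cInf_greatest) auto
  have before: "\<Phi> s x \<in> G" if "0 \<le> s" "s < T" for s
    using cInf_lower[OF _ bdd, of s] that unfolding T_def by force
  have TK: "\<Phi> T x \<in> K"
  proof (cases "T = 0")
    case True thus ?thesis using G by auto
  next
    case False
    hence cl: "closure {0..<T} = {0..T}" using T0 by (simp add: closure_atLeastLessThan)
    have "(\<lambda>s. \<Phi> s x) ` closure {0..<T} \<subseteq> K"
      by (rule image_closure_subset)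
         (use \<Phi>_continuous before G K in \<open>auto simp: cl compact_imp_closed\<close>)
    thus ?thesis using T0 by (auto simp: cl image_subset_iff)
  qed
  have "\<Phi> T x \<notin> G"
  proof
    assume "\<Phi> T x \<in> G"
    hence "\<Phi> (T + 0) x \<in> G" by simp
    moreover have "F y \<in> tangent_space X y" if "y \<in> K" for y
      using that tangent K(2) F(2) by (metis subsetD)
    ultimately obtain h where h: "0 < h" "\<And>s. s \<in> {0..h} \<Longrightarrow> \<Phi> (T + s) x \<in> G"
      using tangent_solution_stays[where u = "\<lambda>s. \<Phi> (T + s) x" and b = 1,
          OF F(1) K _ G(1,2) _ \<Phi>_shift[OF T0] zero_less_one] by blast
    have "T + h \<le> r" if "r \<in> ?S" for r
    proof (rule ccontr)
      assume "\<not> T + h \<le> r"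
      moreover have "T \<le> r" unfolding T_def using that bdd by (rule cInf_lower)
      ultimately have "\<Phi> (T + (r - T)) x \<in> G" by (intro h(2)) auto
      thus False using that by simp
    qed
    hence "T + h \<le> T" using ne unfolding T_def by (intro cInf_greatest) auto
    thus False using h by simp
  qed
  moreover have "\<Phi> s x \<in> K" if "s \<in> {0..T}" for s
    using that before TK G(2) by (cases "s = T") auto
  ultimately show thesis using that T0 by blast
qed

end

section \<open>Relative stability implies stability\<close>

text \<open>A neighbourhood of an unbounded \<open>\<Gamma>\<close> need not contain a uniform tube.
  Within distance \<open>m\<close> of \<open>x\<close>, however, the relevant nearest points lie in
  the compact set \<open>\<Gamma> \<inter> cball x (m + 1)\<close>, as the radius is at most
  1.\<close>

lemma tube_subset_open:
  fixes \<Gamma> :: "'a::euclidean_space set"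
  assumes "closed \<Gamma>" "\<Gamma> \<noteq> {}" "open U" "\<Gamma> \<subseteq> U"
  obtains \<rho> where "0 < \<rho>" "\<And>y. infdist y \<Gamma> \<le> \<rho> \<Longrightarrow> dist x y \<le> m \<Longrightarrow> y \<in> U"
proof -
  have "compact (\<Gamma> \<inter> cball x (m + 1))" using assms by (simp add: closed_Int_compact)
  then obtain \<epsilon> where \<epsilon>: "0 < \<epsilon>" "(\<Union>z\<in>\<Gamma> \<inter> cball x (m + 1). cball z \<epsilon>) \<subseteq> U"
    using compact_subset_open_imp_cball_epsilon_subset[of "\<Gamma> \<inter> cball x (m + 1)" U] assms by blast
  show thesis
  proof (rule that[of "min 1 \<epsilon>"])
    fix y assume y: "infdist y \<Gamma> \<le> min 1 \<epsilon>" "dist x y \<le> m"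
    obtain z where z: "z \<in> \<Gamma>" "infdist y \<Gamma> = dist y z" using infdist_attains_inf assms by blast
    have "z \<in> \<Gamma> \<inter> cball x (m + 1)" using dist_triangle[of x z y] y z by simp
    moreover have "y \<in> cball z \<epsilon>" using y z by (simp add: dist_commute)
    ultimately show "y \<in> U" using \<epsilon>(2) by blast
  qed (use \<epsilon> in simp)
qed

text \<open>The hypothesis \<open>confined\<close> is the common consequence of boundedness of
  \<open>\<Gamma>\<close> and of (iv). With local closedness of \<open>X\<close> it makes the
  relevant region compact.\<close>

lemma stable_near_point:
  fixes X \<Gamma> \<O> :: "(real ^ 'n) set"
  assumes X: "openin (top_of_set (closure X)) X"
    and lipschitz: "local_lipschitz (UNIV :: real set) X (\<lambda>_. f)"
    and tangent: "\<And>x. x \<in> X \<Longrightarrow> f x \<in> tangent_space X x"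
    and \<Gamma>: "closed \<Gamma>" "\<Gamma> \<subseteq> \<O>" "positively_invariant X f \<Gamma>"
    and \<O>: "closedin (top_of_set X) \<O>" "positively_invariant X f \<O>"
    and stable: "asymptotically_stable_relative X f \<Gamma> \<O>" "locally_stable_near X f \<O> \<Gamma>"
    and x: "x \<in> \<Gamma>" and l: "0 < l" and m: "0 < m" and \<epsilon>: "0 < \<epsilon>"
    and confined: "\<And>x0 t u s. dist x x0 < l \<Longrightarrow> ode_solution X f {0..t} x0 u \<Longrightarrow>
      (\<And>s. s \<in> {0..t} \<Longrightarrow> infdist (u s) \<Gamma> \<le> 1) \<Longrightarrow> s \<in> {0..t} \<Longrightarrow> dist x (u s) < m"
  obtains \<eta> where "0 < \<eta>" "flow_into X f {0..} (ball x \<eta> \<inter> X) (set_ball X \<epsilon> \<Gamma>)"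
proof -
  have \<O>X: "\<O> \<subseteq> X" using closedin_imp_subset[OF \<O>(1)] .
  have \<Gamma>ne: "\<Gamma> \<noteq> {}" using x by blast
  have \<Gamma>X: "\<Gamma> \<subseteq> X" using \<Gamma> \<O>X by blast
  \<comment> \<open>\<open>\<O>\<close> is closed only relative to \<open>X\<close>, so a limit must
    be known to lie in \<open>X\<close>; membership in \<open>K\<close> will supply this.\<close>
  have \<O>_lim: "y \<in> \<O>" if "y \<in> X" "\<And>i. q i \<in> \<O>" "q \<longlonglongrightarrow> y" for y and q :: "nat \<Rightarrow> real ^ 'n"
  proof -
    obtain C where C: "closed C" "\<O> = X \<inter> C" using \<O>(1) unfolding closedin_closed by blast
    have "y \<in> C" using C that by (intro closed_sequentially[of C q y]) auto
    thus ?thesis using C that by blast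
  qed
  obtain U where U: "open U" "X = closure X \<inter> U" using X unfolding openin_open by blast
  have \<Gamma>U: "\<Gamma> \<subseteq> U" using \<Gamma>X U(2) by blast
  obtain \<delta>1 where \<delta>1: "0 < \<delta>1" "\<And>y. infdist y \<Gamma> \<le> \<delta>1 \<Longrightarrow> dist x y \<le> m \<Longrightarrow> y \<in> U"
    using tube_subset_open[OF \<Gamma>(1) \<Gamma>ne U(1) \<Gamma>U, of x m] by blast
  obtain N where N: "nbhd_of X \<Gamma> N" and attr: "\<And>x0. x0 \<in> N \<inter> \<O> \<Longrightarrow>
      ((\<lambda>t. infdist (flow X f t x0) \<Gamma>) \<longlongrightarrow> 0) at_top"
    using stable(1) unfolding asymptotically_stable_relative_def attractive_relative_def by blast
  have nbhd: "\<exists>\<rho>>0. \<forall>y\<in>X. infdist y \<Gamma> \<le> \<rho> \<longrightarrow> dist x y \<le> m \<longrightarrow> y \<in> N"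
    if N: "nbhd_of X \<Gamma> N" for N
  proof -
    obtain V where V: "open V" "N = X \<inter> V" using N unfolding nbhd_of_def openin_open by blast
    have "\<Gamma> \<subseteq> V" using N V unfolding nbhd_of_def by blast
    then obtain \<rho> where "0 < \<rho>" "\<And>y. infdist y \<Gamma> \<le> \<rho> \<Longrightarrow> dist x y \<le> m \<Longrightarrow> y \<in> V"
      using tube_subset_open[OF \<Gamma>(1) \<Gamma>ne V(1), of x m] by blast
    thus ?thesis using V by blast
  qed
  obtain \<delta>2 where \<delta>2: "0 < \<delta>2" "\<And>y. y \<in> X \<Longrightarrow> infdist y \<Gamma> \<le> \<delta>2 \<Longrightarrow> dist x y \<le> m \<Longrightarrow> y \<in> N"
    using nbhd[OF N] by blast
  \<comment> \<open>The bounds 1, \<open>\<delta>1\<close>, \<open>\<delta>2\<close> and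
    \<open>\<epsilon> / 2\<close> serve confinement, compactness of \<open>K\<close>, attraction on
    \<open>\<O>\<close> and the final inclusion, in this order.\<close>
  define \<delta> where "\<delta> = min (min 1 \<delta>1) (min \<delta>2 (\<epsilon> / 2))"
  have \<delta>: "0 < \<delta>" "\<delta> \<le> 1" "\<delta> \<le> \<delta>1" "\<delta> \<le> \<delta>2" "\<delta> < \<epsilon>"
    using \<delta>1 \<delta>2 \<epsilon> by (auto simp: \<delta>_def min_def)
  \<comment> \<open>An orbit that starts close to \<open>x\<close> and leaves \<open>G\<close> while
    still in \<open>K\<close> must be at the level \<open>\<delta>\<close>, since confinement keeps
    its distance to \<open>x\<close> strictly below \<open>m\<close>.\<close>
  define K where "K = {y \<in> X. infdist y \<Gamma> \<le> \<delta> \<and> dist x y \<le> m}"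
  define G where "G = {y \<in> X. infdist y \<Gamma> < \<delta> \<and> dist x y < m}"
  \<comment> \<open>These points lie in \<open>U\<close>, where \<open>X\<close> coincides with its
    closure; hence \<open>K\<close> is closed in the ambient space.\<close>
  have "K = closure X \<inter> {y. infdist y \<Gamma> \<le> \<delta>} \<inter> cball x m"
    using U(2) \<delta>1(2) \<delta>(3) closure_subset[of X] unfolding K_def by fastforce
  moreover have "closed {y. infdist y \<Gamma> \<le> \<delta>}"
    by (intro closed_Collect_le continuous_intros)
  ultimately have K: "compact K" by (simp add: closed_Int_compact closed_Int)
  have KX: "K \<subseteq> X" by (auto simp: K_def)
  have xK: "x \<in> K" using x \<Gamma>X \<delta> m by (auto simp: K_def)
  have GK: "G \<subseteq> K" by (auto simp: G_def K_def)
  have "open {y. infdist y \<Gamma> < \<delta> \<and> dist x y < m}"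
    by (intro open_Collect_conj open_Collect_less continuous_intros)
  hence G: "openin (top_of_set X) G"
    unfolding G_def Collect_conj_eq by (auto simp: openin_open)
  obtain L0 where "L0-lipschitz_on K f" using local_lipschitz_compact[OF lipschitz K KX] .
  then obtain L F where F: "L-lipschitz_on UNIV F" "\<And>y. y \<in> K \<Longrightarrow> F y = f y"
    using lipschitz_extension[of L0 K f] xK by blast
  have "\<forall>y. \<exists>u. u 0 = y \<and> (\<forall>t\<ge>0. (u has_vector_derivative F (u t)) (at t within {0..}))"
    by (metis lipschitz_global_solution[OF F(1)])
  then obtain \<Psi> where \<Psi>: "\<And>y. \<Psi> y 0 = y"
      "\<And>y t. 0 \<le> t \<Longrightarrow> (\<Psi> y has_vector_derivative F (\<Psi> y t)) (at t within {0..})"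
    by metis
  define \<Phi> where "\<Phi> t y = \<Psi> y t" for t y
  interpret lipschitz_extended_field X K f F L \<Phi>
    by unfold_locales (use lipschitz tangent K KX F \<Psi> in \<open>auto simp: \<Phi>_def\<close>)

  have \<Phi>_close: "dist x (\<Phi> s y) < m"
    if y: "dist x y < l" and inK: "\<And>s. s \<in> {0..t} \<Longrightarrow> \<Phi> s y \<in> K" and s: "s \<in> {0..t}" for s t y
  proof (rule confined[OF y \<Phi>_solution[OF inK] _ s])
    show "infdist (\<Phi> r y) \<Gamma> \<le> 1" if "r \<in> {0..t}" for r
      using inK[OF that] \<delta>(2) by (simp add: K_def)
  qed (use s in auto)

  \<comment> \<open>Invariance is given for \<open>flow\<close>; confinement puts that orbit into
    \<open>K\<close>, where it must coincide with \<open>\<Phi>\<close>.\<close>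
  have \<Phi>_\<Gamma>: "\<Phi> t x \<in> \<Gamma>" if "0 \<le> t" for t
  proof -
    have inv: "s \<in> existence_interval X f x" "flow X f s x \<in> \<Gamma>" if "0 \<le> s" for s
      using \<Gamma>(3) x that unfolding positively_invariant_def flow_into_def by auto
    note sol = flow_solution[OF lipschitz inv(1)[OF that] that]
    have "dist x (flow X f s x) < m" if "s \<in> {0..t}" for s
      by (rule confined[OF _ sol _ that]) (use l inv in auto)
    hence "flow X f s x \<in> K" if "s \<in> {0..t}" for s
      using that inv(2)[of s] \<Gamma>X \<delta>(1) unfolding K_def by (auto simp: less_imp_le)
    from solution_eq_\<Phi>[OF sol this, of t] show ?thesis using that inv(2)[of t] by auto
  qed

  have "\<exists>\<eta>>0. \<forall>y\<in>X. dist x y < \<eta> \<longrightarrow> (\<forall>t\<ge>0. \<Phi> t y \<in> G)"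
  proof (rule ccontr)
    assume contr: "\<not> ?thesis"
    have "\<exists>y t. y \<in> X \<and> dist x y < 1 / (real i + 1) \<and> 0 \<le> t \<and> (\<forall>s\<in>{0..t}. \<Phi> s y \<in> K) \<and>
        infdist (\<Phi> t y) \<Gamma> = \<delta>" for i
    proof -
      \<comment> \<open>The bounds \<open>\<delta>\<close> and \<open>m\<close> put \<open>y\<close>
        into \<open>G\<close>, and the bound \<open>l\<close> gives confinement.\<close>
      have "0 < min (1 / (real i + 1)) (min l (min \<delta> m))" using l \<delta> m by auto
      then obtain y t where y: "y \<in> X" "dist x y < min (1 / (real i + 1)) (min l (min \<delta> m))"
          and t: "0 \<le> t" "\<Phi> t y \<notin> G"
        using contr by meson
      have "infdist y \<Gamma> \<le> dist x y" using infdist_le[OF x, of y] by (simp add: dist_commute)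
      hence "y \<in> G" using y by (auto simp: G_def)
      from first_exit[OF G GK this t] obtain T where
        T: "0 \<le> T" "\<Phi> T y \<notin> G" "\<And>s. s \<in> {0..T} \<Longrightarrow> \<Phi> s y \<in> K" by blast
      have "dist x (\<Phi> T y) < m" using \<Phi>_close[OF _ T(3)] y T(1) by auto
      hence "infdist (\<Phi> T y) \<Gamma> = \<delta>"
        using T(1,2) T(3)[of T] unfolding G_def K_def by auto
      thus ?thesis using T y by (intro exI[of _ y] exI[of _ T]) auto
    qed
    then obtain q T where qX: "\<And>i. q i \<in> X" and qx: "\<And>i. dist x (q i) < 1 / (real i + 1)"
      and T0: "\<And>i. 0 \<le> T i" and qK: "\<And>i s. s \<in> {0..T i} \<Longrightarrow> \<Phi> s (q i) \<in> K"
      and exit: "\<And>i. infdist (\<Phi> (T i) (q i)) \<Gamma> = \<delta>"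
      by metis
    have inv_0: "(\<lambda>i. 1 / (real i + 1)) \<longlonglongrightarrow> 0"
      using LIMSEQ_inverse_real_of_nat by (simp add: inverse_eq_divide add.commute)
    have q_close: "\<forall>\<^sub>F i in sequentially. dist x (q i) < e" if "0 < e" for e
      using order_tendstoD(2)[OF inv_0 that] by eventually_elim (use qx less_trans in blast)

    \<comment> \<open>The orbit of \<open>x\<close> stays in \<open>\<Gamma>\<close>, so at time
      \<open>T i\<close> the two orbits are at least \<open>\<delta>\<close> apart. Continuous
      dependence excludes this on \<open>{0..b}\<close> once \<open>q i\<close> is close enough to
      \<open>x\<close>.\<close>
    have T_large: "\<forall>\<^sub>F i in sequentially. b < T i" if b: "0 \<le> b" for b
    proof -
      have "\<forall>\<^sub>F i in sequentially. dist x (q i) < \<delta> / exp (L * b)" using \<delta> by (intro q_close) simp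
      thus ?thesis
      proof eventually_elim
        fix i assume i: "dist x (q i) < \<delta> / exp (L * b)"
        show "b < T i"
        proof (rule ccontr)
          assume "\<not> b < T i"
          hence exp: "exp (L * T i) \<le> exp (L * b)"
            using lipschitz_on_nonneg[OF F(1)] by (auto intro: mult_left_mono)
          have "\<delta> \<le> dist (\<Phi> (T i) (q i)) (\<Phi> (T i) x)"
            unfolding exit[of i, symmetric] by (intro infdist_le \<Phi>_\<Gamma> T0)
          also have "\<dots> \<le> dist (q i) x * exp (L * T i)" by (rule \<Phi>_dist[OF T0])
          also have "\<dots> \<le> dist (q i) x * exp (L * b)" using exp by (rule mult_left_mono) simp
          also have "\<dots> < \<delta>" using i by (simp add: pos_less_divide_eq dist_commute)
          finally show False by simp
        qed
      qed
    qed

    have near_\<O>: "\<forall>\<^sub>F i in sequentially. \<forall>s\<in>{0..T i}. infdist (\<Phi> s (q i)) \<O> < e" if e: "0 < e" for e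
    proof -
      \<comment> \<open>The larger radius turns the closed bound \<open>dist x y \<le> m\<close> on
        \<open>K\<close> into the open ball that occurs in (ii).\<close>
      have "0 < m + 1" using m by simp
      then obtain d where d: "0 < d" and D: "\<And>y t. y \<in> set_ball X d \<Gamma> \<Longrightarrow> 0 < t \<Longrightarrow>
          flow_into X f {0..t} {y} (ball x (m + 1) \<inter> X) \<Longrightarrow> flow_into X f {0..t} {y} (set_ball X e \<O>)"
        using stable(2) x e unfolding locally_stable_near_def by meson
      from q_close[OF d] T_large[OF order_refl] show ?thesis
      proof eventually_elim
        fix i assume i: "dist x (q i) < d" "0 < T i"
        have fl: "s \<in> existence_interval X f (q i)" "flow X f s (q i) = \<Phi> s (q i)"
          if "s \<in> {0..T i}" for s
          using flow_eq_\<Phi>[of s "q i"] qK that by auto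
        have "infdist (q i) \<Gamma> < d"
          using i(1) infdist_le[OF x, of "q i"] by (simp add: dist_commute)
        hence "q i \<in> set_ball X d \<Gamma>" by (simp add: set_ball_def qX)
        moreover have "flow_into X f {0..T i} {q i} (ball x (m + 1) \<inter> X)"
        proof -
          have "\<Phi> s (q i) \<in> ball x (m + 1) \<inter> X" if "s \<in> {0..T i}" for s
            using qK[OF that] by (simp add: K_def)
          thus ?thesis using fl unfolding flow_into_def by simp
        qed
        ultimately have "flow_into X f {0..T i} {q i} (set_ball X e \<O>)" using D i(2) by blast
        thus "\<forall>s\<in>{0..T i}. infdist (\<Phi> s (q i)) \<O> < e"
          using fl unfolding flow_into_def set_ball_def by auto
      qed
    qed

    have "\<exists>z. z \<in> \<O> \<and> (\<forall>s\<in>{0..real n}. \<Phi> s z \<in> K) \<and> infdist (\<Phi> (real n) z) \<Gamma> = \<delta>" for n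
    proof -
      \<comment> \<open>Truncation at 0 affects only finitely many \<open>i\<close> and keeps every
        \<open>w i\<close> in \<open>K\<close>, so that a subsequence converges.\<close>
      define w where "w i = \<Phi> (max 0 (T i - real n)) (q i)" for i
      have wK: "w i \<in> K" for i unfolding w_def using T0[of i] by (intro qK) auto
      then obtain z r where z: "z \<in> K" and r: "strict_mono r" and lim: "(w \<circ> r) \<longlonglongrightarrow> z"
        using K(1) unfolding compact_def by meson
      have sub: "\<forall>\<^sub>F i in sequentially. P (r i)" if "\<forall>\<^sub>F i in sequentially. P i" for P
        using eventually_subseq[OF r that] .
      have lim\<Phi>: "(\<lambda>i. \<Phi> s (w (r i))) \<longlonglongrightarrow> \<Phi> s z" if "0 \<le> s" for s
        using \<Phi>_tendsto[OF that lim] by (simp add: o_def)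
      have late: "\<forall>\<^sub>F i in sequentially. real n < T (r i)" by (intro sub T_large) simp
      have w_shift: "\<Phi> s (w i) = \<Phi> (T i - real n + s) (q i)" if "0 \<le> s" "real n < T i" for s i
        using \<Phi>_add[of "T i - real n" s "q i"] that by (simp add: w_def)
      have "infdist z \<O> = 0"
      proof (rule ccontr)
        assume "infdist z \<O> \<noteq> 0"
        hence pos: "0 < infdist z \<O>" using infdist_nonneg[of z \<O>] by simp
        have "(\<lambda>i. infdist (w (r i)) \<O>) \<longlonglongrightarrow> infdist z \<O>"
          using lim by (intro tendsto_infdist) (simp add: o_def)
        hence "\<forall>\<^sub>F i in sequentially. infdist z \<O> / 2 < infdist (w (r i)) \<O>"
          using pos by (intro order_tendstoD(1)) auto
        moreover have "\<forall>\<^sub>F i in sequentially. infdist (w (r i)) \<O> < infdist z \<O> / 2"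
        proof -
          have "\<forall>\<^sub>F i in sequentially. \<forall>s\<in>{0..T (r i)}. infdist (\<Phi> s (q (r i))) \<O> < infdist z \<O> / 2"
            using pos by (intro sub near_\<O>) simp
          thus ?thesis by eventually_elim (use T0 in \<open>auto simp: w_def\<close>)
        qed
        ultimately have "\<forall>\<^sub>F i in sequentially. False" by eventually_elim simp
        thus False by simp
      qed
      moreover have "\<O> \<noteq> {}" using \<Gamma>(2) x by blast
      ultimately have "z \<in> closure \<O>" by (simp add: in_closure_iff_infdist_zero)
      hence "z \<in> \<O>" using \<O>_lim z KX unfolding closure_sequential by blast
      moreover have "\<Phi> s z \<in> K" if s: "s \<in> {0..real n}" for s
      proof (rule Lim_in_closed_set[OF compact_imp_closed[OF K(1)] _ _ lim\<Phi>])
        show "\<forall>\<^sub>F i in sequentially. \<Phi> s (w (r i)) \<in> K"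
          using late by eventually_elim (use s w_shift qK in auto)
      qed (use s in auto)
      moreover have "infdist (\<Phi> (real n) z) \<Gamma> = \<delta>"
      proof (rule LIMSEQ_unique)
        show "(\<lambda>i. infdist (\<Phi> (real n) (w (r i))) \<Gamma>) \<longlonglongrightarrow> infdist (\<Phi> (real n) z) \<Gamma>"
          by (intro tendsto_infdist lim\<Phi>) simp
        show "(\<lambda>i. infdist (\<Phi> (real n) (w (r i))) \<Gamma>) \<longlonglongrightarrow> \<delta>"
          by (rule tendsto_eventually) (use late in eventually_elim, use w_shift exit in auto)
      qed
      ultimately show ?thesis by blast
    qed
    then obtain z where z\<O>: "\<And>n. z n \<in> \<O>" and zK: "\<And>n s. s \<in> {0..real n} \<Longrightarrow> \<Phi> s (z n) \<in> K"
      and z_exit: "\<And>n. infdist (\<Phi> (real n) (z n)) \<Gamma> = \<delta>"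
      by metis
    \<comment> \<open>Second passage to the limit: the times \<open>n\<close> up to which the orbit
      of \<open>z n\<close> stays in \<open>K\<close> grow, so the limit stays in \<open>K\<close>
      forever.\<close>
    have "z n \<in> K" for n using zK[of 0 n] by simp
    then obtain y r where y: "y \<in> K" and r: "strict_mono r" and lim: "(z \<circ> r) \<longlonglongrightarrow> y"
      using K(1) unfolding compact_def by meson
    have r_large: "\<forall>\<^sub>F i in sequentially. s \<le> real (r i)" for s
      using filterlim_compose[OF filterlim_real_sequentially filterlim_subseq[OF r]]
      by (simp add: filterlim_at_top)
    have lim\<Phi>: "(\<lambda>i. \<Phi> s (z (r i))) \<longlonglongrightarrow> \<Phi> s y" if "0 \<le> s" for s
      using \<Phi>_tendsto[OF that lim] by (simp add: o_def)
    have y\<O>: "y \<in> \<O>" using \<O>_lim[OF _ _ lim] y KX z\<O> by auto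
    have yK: "\<Phi> s y \<in> K" if "0 \<le> s" for s
    proof (rule Lim_in_closed_set[OF compact_imp_closed[OF K(1)] _ _ lim\<Phi>[OF that]])
      show "\<forall>\<^sub>F i in sequentially. \<Phi> s (z (r i)) \<in> K"
        using r_large[of s] by eventually_elim (use zK that in auto)
    qed auto
    have "y \<in> N" using y \<delta>2(2) \<delta>(4) unfolding K_def by auto
    hence "((\<lambda>t. infdist (flow X f t y) \<Gamma>) \<longlongrightarrow> 0) at_top" using attr y\<O> by blast
    hence attr_y: "((\<lambda>t. infdist (\<Phi> t y) \<Gamma>) \<longlongrightarrow> 0) at_top"
      by (rule Lim_transform_eventually)
         (use eventually_ge_at_top[of 0] in eventually_elim, use yK flow_eq_\<Phi>(2) in auto)
    obtain M where M: "nbhd_of X \<Gamma> M" "flow_into X f {0..} (M \<inter> \<O>) (set_ball X (\<delta> / 2) \<Gamma>)"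
      using stable(1) \<delta>(1) half_gt_zero[OF \<delta>(1)]
      unfolding asymptotically_stable_relative_def stable_relative_def by blast
    obtain \<rho> where \<rho>: "0 < \<rho>" "\<And>y. y \<in> X \<Longrightarrow> infdist y \<Gamma> \<le> \<rho> \<Longrightarrow> dist x y \<le> m \<Longrightarrow> y \<in> M"
      using nbhd[OF M(1)] by blast
    obtain V where V: "open V" "M = X \<inter> V" using M(1) unfolding nbhd_of_def openin_open by blast
    have "\<forall>\<^sub>F s in at_top. infdist (\<Phi> s y) \<Gamma> < \<rho> \<and> (0::real) \<le> s"
      using order_tendstoD(2)[OF attr_y \<rho>(1)] eventually_ge_at_top by (rule eventually_conj)
    then obtain s where s: "infdist (\<Phi> s y) \<Gamma> < \<rho>" "0 \<le> s"
      using eventually_happens'[OF trivial_limit_at_top_linorder] by blast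
    \<comment> \<open>The time \<open>s\<close> is now fixed, so continuity in the initial point
      brings \<open>\<Phi> s (z (r i))\<close> into the open set \<open>V\<close> too;
      \<open>s \<le> real (r i)\<close> makes this happen no later than the exit time.\<close>
    have "\<Phi> s y \<in> V" using \<rho>(2)[of "\<Phi> s y"] s yK[OF s(2)] V unfolding K_def by auto
    hence "\<forall>\<^sub>F i in sequentially. \<Phi> s (z (r i)) \<in> V"
      by (rule topological_tendstoD[OF lim\<Phi>[OF s(2)] V(1)])
    from eventually_conj[OF this r_large[of s]]
    obtain i where i: "\<Phi> s (z (r i)) \<in> V" "s \<le> real (r i)"
      using eventually_happens'[OF sequentially_bot] by blast
    define n where "n = r i"
    define p where "p = \<Phi> s (z n)"
    have "flow X f s (z n) = p" unfolding p_def
      by (rule flow_eq_\<Phi>) (use zK i s in \<open>auto simp: n_def\<close>)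
    hence "p \<in> \<O>"
      using \<O>(2) z\<O> s(2) unfolding positively_invariant_def flow_into_def by (metis atLeast_iff)
    moreover have "p \<in> M"
      using V i zK[of s n] s KX unfolding p_def n_def by auto
    \<comment> \<open>After the remaining time the orbit is at \<open>\<Phi> (real n) (z n)\<close>,
      whose distance to \<open>\<Gamma>\<close> is \<open>\<delta>\<close> and not below
      \<open>\<delta> / 2\<close>.\<close>
    ultimately have "flow X f (real n - s) p \<in> set_ball X (\<delta> / 2) \<Gamma>"
      using M(2) i(2) unfolding flow_into_def n_def by auto
    moreover have "flow X f (real n - s) p = \<Phi> (real n - s) p"
    proof (rule flow_eq_\<Phi>)
      show "\<Phi> t p \<in> K" if "t \<in> {0..real n - s}" for t
        using zK[of "s + t" n] that s \<Phi>_add[of s t "z n"] by (simp add: p_def)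
    qed (use i in \<open>simp add: n_def\<close>)
    moreover have "\<Phi> (real n - s) p = \<Phi> (real n) (z n)"
      using \<Phi>_add[of s "real n - s" "z n"] s i by (simp add: p_def n_def)
    ultimately show False using z_exit[of n] \<delta>(1) by (simp add: set_ball_def)
  qed
  then obtain \<eta> where \<eta>: "0 < \<eta>" "\<And>y t. y \<in> X \<Longrightarrow> dist x y < \<eta> \<Longrightarrow> 0 \<le> t \<Longrightarrow> \<Phi> t y \<in> G"
    by blast
  have "flow_into X f {0..} (ball x \<eta> \<inter> X) (set_ball X \<epsilon> \<Gamma>)"
    unfolding flow_into_def
  proof (intro ballI)
    fix y t assume y: "y \<in> ball x \<eta> \<inter> X" and t: "t \<in> {0::real..}"
    have "\<Phi> s y \<in> G" if "0 \<le> s" for s using \<eta>(2) y that by auto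
    moreover from this have "\<Phi> s y \<in> K" if "s \<in> {0..t}" for s using that GK by auto
    ultimately show "t \<in> existence_interval X f y \<and> flow X f t y \<in> set_ball X \<epsilon> \<Gamma>"
      using flow_eq_\<Phi>[of t y] t \<delta>(5) unfolding G_def set_ball_def by (auto intro: less_trans)
  qed
  thus thesis using that \<eta>(1) by blast
qed

text \<open>The chart \<open>\<psi>\<close> maps \<open>X \<inter> U\<close> into the closed
  subspace \<open>L\<close>, so by continuity it maps limits in \<open>U\<close> of points of
  \<open>X\<close> into \<open>L\<close> as well; injectivity of \<open>\<psi>\<close> on
  \<open>U\<close> returns them to \<open>X\<close>.\<close>

lemma smooth_submanifold_locally_closed:
  fixes X :: "(real ^ 'n) set"
  assumes "smooth_submanifold k X"
  shows "openin (top_of_set (closure X)) X"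
proof (rule openin_subopen[THEN iffD2], rule ballI)
  fix p assume p: "p \<in> X"
  then obtain U V L :: "(real ^ 'n) set" and \<psi> \<psi>' where U: "open U" "p \<in> U" and hom: "homeomorphism U V \<psi> \<psi>'"
    and L: "subspace L" "\<psi> ` (X \<inter> U) = V \<inter> L"
    using assms unfolding smooth_submanifold_def by meson
  have "closure X \<inter> U \<subseteq> X"
  proof
    fix y assume y: "y \<in> closure X \<inter> U"
    then obtain q where q: "\<And>i. q i \<in> X" "q \<longlonglongrightarrow> y"
      using closure_sequential[of y X] by blast
    have "\<forall>\<^sub>F i in sequentially. q i \<in> U" using q(2) U(1) y by (auto dest: topological_tendstoD)
    hence "\<forall>\<^sub>F i in sequentially. \<psi> (q i) \<in> L"
      by eventually_elim (use q(1) L(2) in blast)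
    moreover have "isCont \<psi> y"
      using hom U(1) y continuous_on_eq_continuous_at unfolding homeomorphism_def by blast
    hence "(\<lambda>i. \<psi> (q i)) \<longlonglongrightarrow> \<psi> y" using q(2) by (rule isCont_tendsto_compose)
    ultimately have "\<psi> y \<in> L"
      by (intro Lim_in_closed_set[OF closed_subspace[OF L(1)] _ sequentially_bot])
    moreover have "\<psi> y \<in> V" using hom y unfolding homeomorphism_def by blast
    ultimately obtain x where x: "x \<in> X \<inter> U" "\<psi> y = \<psi> x" using L(2) by (metis IntI imageE)
    hence "y = x" using hom y unfolding homeomorphism_def by (metis IntD2)
    thus "y \<in> X" using x by blast
  qed
  moreover have "openin (top_of_set (closure X)) (closure X \<inter> U)" using U(1) by blast
  ultimately show "\<exists>T. openin (top_of_set (closure X)) T \<and> p \<in> T \<and> T \<subseteq> X"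
    using p U(2) closure_subset by blast
qed

theorem theorem3p3:
  fixes X \<Gamma> \<O> :: "(real ^ 'n) set"
    and f :: "real ^ 'n \<Rightarrow> real ^ 'n"
  assumes "open X \<or> (\<exists>k. smooth_submanifold k X)"
    and "locally_lipschitz_vector_field X f"
    and "\<Gamma> \<noteq> {}" and "\<Gamma> \<subseteq> \<O>" and "\<O> \<subseteq> X"
    and "closed \<Gamma>" and "closedin (top_of_set X) \<O>"
    and "positively_invariant X f \<Gamma>" and "positively_invariant X f \<O>"
    and "asymptotically_stable_relative X f \<Gamma> \<O>"
    and "locally_stable_near X f \<O> \<Gamma>"
    and "\<not> bounded \<Gamma> \<longrightarrow> locally_uniformly_bounded_near X f \<Gamma>"
  shows "stable_set X f \<Gamma>"
proof -
  have X: "openin (top_of_set (closure X)) X"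
    using assms(1) smooth_submanifold_locally_closed closure_subset
    by (metis open_subset)
  have lip: "local_lipschitz (UNIV :: real set) X (\<lambda>_. f)"
    and tangent: "\<And>x. x \<in> X \<Longrightarrow> f x \<in> tangent_space X x"
    using assms(2) unfolding locally_lipschitz_vector_field_def by auto
  \<comment> \<open>If \<open>\<Gamma>\<close> is bounded, its unit tube lies in a ball about
    \<open>x\<close>; otherwise (iv) supplies both constants.\<close>
  have confined: "\<exists>l>0. \<exists>m>0. \<forall>x0 t u. dist x x0 < l \<longrightarrow> ode_solution X f {0..t} x0 u \<longrightarrow>
      (\<forall>s\<in>{0..t}. infdist (u s) \<Gamma> \<le> 1) \<longrightarrow> (\<forall>s\<in>{0..t}. dist x (u s) < m)" if x: "x \<in> \<Gamma>" for x
  proof (cases "bounded \<Gamma>")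
    case True
    then obtain R where R: "0 < R" "\<And>y. y \<in> \<Gamma> \<Longrightarrow> dist x y < R"
      using bounded_subset_ballD[of \<Gamma> x] by (auto simp: subset_iff)
    have "dist x y < R + 1" if "infdist y \<Gamma> \<le> 1" for y
    proof -
      obtain z where z: "z \<in> \<Gamma>" "infdist y \<Gamma> = dist y z"
        using infdist_attains_inf[OF assms(6,3)] by blast
      show ?thesis using R(2)[OF z(1)] z(2) that dist_triangle2[of x y z] by simp
    qed
    thus ?thesis using R(1) by (intro exI[of _ 1] exI[of _ "R + 1"] conjI) auto
  next
    case False
    then obtain l m where lm: "0 < l" "0 < m" and B: "flow_into X f {0..} (ball x l \<inter> X) (ball x m \<inter> X)"
      using assms(12) x unfolding locally_uniformly_bounded_near_def by blast
    have "dist x (u s) < m" if "dist x x0 < l" "ode_solution X f {0..t} x0 u" "s \<in> {0..t}" for x0 t u s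
    proof -
      have "x0 \<in> X" using that(2) unfolding ode_solution_def by auto
      hence "flow X f s x0 \<in> ball x m" using B that unfolding flow_into_def by auto
      thus ?thesis using flow_eq[OF lip that(2,3)] that(3) by simp
    qed
    thus ?thesis using lm by blast
  qed
  show ?thesis unfolding stable_set_def
  proof (intro allI impI)
    fix \<epsilon> :: real assume \<epsilon>: "0 < \<epsilon>"
    have "\<exists>\<eta>>0. flow_into X f {0..} (ball x \<eta> \<inter> X) (set_ball X \<epsilon> \<Gamma>)" if x: "x \<in> \<Gamma>" for x
    proof -
      obtain l m where lm: "0 < l" "0 < m" and C: "\<And>x0 t u s. dist x x0 < l \<Longrightarrow>
          ode_solution X f {0..t} x0 u \<Longrightarrow> (\<And>s. s \<in> {0..t} \<Longrightarrow> infdist (u s) \<Gamma> \<le> 1) \<Longrightarrow>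
          s \<in> {0..t} \<Longrightarrow> dist x (u s) < m"
        using confined[OF x] by metis
      show ?thesis
      proof (rule stable_near_point[OF X lip tangent assms(6,4,8,7,9,10,11) x lm \<epsilon>])
        show "dist x (u s) < m" if "dist x x0 < l" "ode_solution X f {0..t} x0 u"
          "\<And>s. s \<in> {0..t} \<Longrightarrow> infdist (u s) \<Gamma> \<le> 1" "s \<in> {0..t}" for x0 t u s
          using that by (rule C)
      qed blast+
    qed
    then obtain \<eta> where \<eta>: "\<And>x. x \<in> \<Gamma> \<Longrightarrow> 0 < \<eta> x"
        "\<And>x. x \<in> \<Gamma> \<Longrightarrow> flow_into X f {0..} (ball x (\<eta> x) \<inter> X) (set_ball X \<epsilon> \<Gamma>)"
      by metis
    \<comment> \<open>The radii may shrink along an unbounded \<open>\<Gamma>\<close>; a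
      neighbourhood asks for no uniform radius.\<close>
    define N where "N = (\<Union>x\<in>\<Gamma>. ball x (\<eta> x)) \<inter> X"
    have "nbhd_of X \<Gamma> N"
      unfolding nbhd_of_def
    proof
      have "open (\<Union>x\<in>\<Gamma>. ball x (\<eta> x))" by blast
      thus "openin (top_of_set X) N" unfolding N_def by (auto simp: openin_open)
      show "\<Gamma> \<subseteq> N" using \<eta>(1) assms(4,5) unfolding N_def by force
    qed
    moreover have "flow_into X f {0..} N (set_ball X \<epsilon> \<Gamma>)"
      using \<eta>(2) unfolding flow_into_def N_def by blast
    ultimately show "\<exists>N. nbhd_of X \<Gamma> N \<and> flow_into X f {0..} N (set_ball X \<epsilon> \<Gamma>)" by blast
  qed
qed

end
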